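(* Let $p\ge2$ and let $\mathbf{A}$ be a $p$-ary groupoid such that $s_n(\mathbf{A})=1$ for some $n\in\mathbb{N}$, $n\ge2$. Then there exists a finite $p$-ary groupoid $\mathbf{B}$ with $\sigma(\mathbf{B})=\sigma(\mathbf{A})$.
   Context: $\mathbb{N}$ includes $0$; $p\ge 2$ is an integer. $T$ is the set of $p$-ary bracketings: terms (prefix notation) over the single variable $x$ and the $p$-ary operation symbol $\omega$, i.e. $x\in T$, and $\omega t_1\ldots t_p\in T$ whenever $t_1,\ldots,t_p\in T$. $|t|_\omega$ is the number of occurrences of $\omega$ in $t$; $B_n^{(p)}=\{t\in T:|t|_\omega=n\}$; $\Lambda^{(p)}=\{(s,t)\in T\times T:|s|_\omega=|t|_\omega\}$. A $p$-ary groupoid is an algebra with one $p$-ary operation. $\varepsilon_1(t)$ is the term obtained from $t$ by replacing the occurrences of $x$, from left to right, by distinct variables $x_1,x_2,\ldots$. The fine spectrum $\sigma(\mathbf{A})$ is the set of all $(s,t)\in\Lambda^{(p)}$ such that $\mathbf{A}$ satisfies the identity $\varepsilon_1(s)\approx\varepsilon_1(t)$; $\sigma_n(\mathbf{A})=\sigma(\mathbf{A})\cap(B_n^{(p)}\times B_n^{(p)})$; the associative spectrum is $s_n(\mathbf{A})=|B_n^{(p)}/\sigma_n(\mathbf{A})|$. *)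

theory Defs
  imports Main
begin

text \<open>
  Terms over one operation symbol applied to argument lists. The arity is not built into
  the type; it is imposed by \<open>bracketings p\<close> below. The one-variable terms are the terms of
  type \<open>unit trm\<close>.
\<close>

datatype 'v trm = Var 'v | Op "'v trm list"

abbreviation X :: "unit trm" where
  "X \<equiv> Var ()"

inductive_set bracketings :: "nat \<Rightarrow> unit trm set" for p :: nat where
  "X \<in> bracketings p"
| "length ts = p \<Longrightarrow> (\<And>t. t \<in> set ts \<Longrightarrow> t \<in> bracketings p) \<Longrightarrow> Op ts \<in> bracketings p"

primrec op_count :: "'v trm \<Rightarrow> nat" where
  "op_count (Var v) = 0"
| "op_count (Op ts) = Suc (sum_list (map op_count ts))"

primrec var_count :: "'v trm \<Rightarrow> nat" where
  "var_count (Var v) = 1"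
| "var_count (Op ts) = sum_list (map var_count ts)"

definition bracketings_of_size :: "nat \<Rightarrow> nat \<Rightarrow> unit trm set" where
  "bracketings_of_size p n = {t \<in> bracketings p. op_count t = n}"

definition Lambda :: "nat \<Rightarrow> (unit trm \<times> unit trm) set" where
  "Lambda p = {(s, t). s \<in> bracketings p \<and> t \<in> bracketings p \<and> op_count s = op_count t}"

text \<open>
  \<open>number_vars i t\<close> replaces the variable occurrences of \<open>t\<close>, from left to right, by the
  variables with indices \<open>i, i + 1, i + 2, \<dots>\<close>.
\<close>

fun number_vars :: "nat \<Rightarrow> 'v trm \<Rightarrow> nat trm"
  and number_vars_list :: "nat \<Rightarrow> 'v trm list \<Rightarrow> nat trm list" where
  "number_vars i (Var v) = Var i"
| "number_vars i (Op ts) = Op (number_vars_list i ts)"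
| "number_vars_list i [] = []"
| "number_vars_list i (t # ts) = number_vars i t # number_vars_list (i + var_count t) ts"

definition epsilon1 :: "unit trm \<Rightarrow> nat trm" where
  "epsilon1 t = number_vars 1 t"

text \<open>
  The operation of a \<open>p\<close>-ary groupoid is a function on lists; only its values on lists of
  length \<open>p\<close> over the carrier matter. As usual for algebras, the carrier is nonempty.
\<close>

definition p_groupoid :: "nat \<Rightarrow> 'a set \<Rightarrow> ('a list \<Rightarrow> 'a) \<Rightarrow> bool" where
  "p_groupoid p A f \<longleftrightarrow>
     A \<noteq> {} \<and> (\<forall>as. length as = p \<and> set as \<subseteq> A \<longrightarrow> f as \<in> A)"

primrec eval_trm :: "('a list \<Rightarrow> 'a) \<Rightarrow> ('v \<Rightarrow> 'a) \<Rightarrow> 'v trm \<Rightarrow> 'a" where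
  "eval_trm f h (Var v) = h v"
| "eval_trm f h (Op ts) = f (map (eval_trm f h) ts)"

definition satisfies_identity :: "'a set \<Rightarrow> ('a list \<Rightarrow> 'a) \<Rightarrow> 'v trm \<Rightarrow> 'v trm \<Rightarrow> bool" where
  "satisfies_identity A f s t \<longleftrightarrow>
     (\<forall>h. (\<forall>v. h v \<in> A) \<longrightarrow> eval_trm f h s = eval_trm f h t)"

definition fine_spectrum ::
    "nat \<Rightarrow> 'a set \<Rightarrow> ('a list \<Rightarrow> 'a) \<Rightarrow> (unit trm \<times> unit trm) set" where
  "fine_spectrum p A f =
     {(s, t) \<in> Lambda p. satisfies_identity A f (epsilon1 s) (epsilon1 t)}"

definition fine_spectrum_at ::
    "nat \<Rightarrow> 'a set \<Rightarrow> ('a list \<Rightarrow> 'a) \<Rightarrow> nat \<Rightarrow> (unit trm \<times> unit trm) set" where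
  "fine_spectrum_at p A f n =
     fine_spectrum p A f \<inter> (bracketings_of_size p n \<times> bracketings_of_size p n)"

definition assoc_spectrum :: "nat \<Rightarrow> 'a set \<Rightarrow> ('a list \<Rightarrow> 'a) \<Rightarrow> nat \<Rightarrow> nat" where
  "assoc_spectrum p A f n = card (bracketings_of_size p n // fine_spectrum_at p A f n)"

end

theory Submission
  imports Defs
begin

text \<open>
  The fine spectrum \<open>\<sigma>\<close> of \<open>A\<close> is a congruence on bracketings and is closed under substituting
  bracketings for leaves. If all bracketings of some size \<open>m \<ge> 2\<close> are \<open>\<sigma>\<close>-equivalent, so are
  those of size \<open>m + 1\<close>: contracting an innermost \<open>\<omega>x\<dots>x\<close> to a leaf, rearranging the resulting term
  of size \<open>m\<close> and expanding the leaf again brings every term to the form \<open>\<omega>sx\<dots>x\<close> or \<open>\<omega>x\<dots>xs\<close>, and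
  these two forms are linked by expanding the \<open>p\<close>-th leaf, which lies below \<open>s\<close> in both. Hence \<open>\<sigma>\<close> is
  determined by its finitely many classes of size below \<open>n\<close>, and \<open>B\<close> is the algebra of bracketings modulo
  \<open>\<sigma>\<close> with all bracketings of size at least \<open>n\<close> collapsed to one absorbing element.
\<close>

section \<open>Bracketings: leaf counts and finiteness\<close>

lemma Var_in_bracketings [simp]: "Var u \<in> bracketings p"
  by (cases u) (simp add: bracketings.intros)

lemma Op_in_bracketings_iff [simp]:
  "Op ts \<in> bracketings p \<longleftrightarrow> length ts = p \<and> set ts \<subseteq> bracketings p"
  by (subst bracketings.simps) auto

text \<open>Each \<open>Op\<close> turns one leaf into \<open>p\<close> leaves. Hence terms of equal
  size have equally many leaves, and replacing an argument by one of the same size leaves the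
  numbering of its right siblings unchanged.\<close>

lemma var_count_bracketing:
  assumes "t \<in> bracketings p" "p \<ge> 1"
  shows "var_count t = (p - 1) * op_count t + 1"
  using assms(1)
proof (induction t rule: trm.induct)
  case (Var u)
  then show ?case by simp
next
  case (Op ts)
  have "\<forall>t \<in> set ts. var_count t = (p - 1) * op_count t + 1"
    using Op by auto
  then have "sum_list (map var_count ts) = (p - 1) * sum_list (map op_count ts) + length ts"
    by (induction ts) (simp_all add: algebra_simps)
  moreover obtain q where "p = Suc q"
    using \<open>p \<ge> 1\<close> by (cases p) auto
  ultimately show ?case
    using Op.prems by (simp add: algebra_simps)
qed

text \<open>A compound term of size below \<open>Suc n\<close> is given by \<open>p\<close>
  arguments of size below \<open>n\<close>.\<close>

lemma finite_bracketings_less: "finite {t \<in> bracketings p. op_count t < n}"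
proof (induction n)
  case 0
  then show ?case by simp
next
  case (Suc n)
  let ?S = "{t \<in> bracketings p. op_count t < n}"
  have "{t \<in> bracketings p. op_count t < Suc n} \<subseteq> insert X (Op ` {ts. set ts \<subseteq> ?S \<and> length ts = p})"
  proof
    fix t assume t: "t \<in> {t \<in> bracketings p. op_count t < Suc n}"
    show "t \<in> insert X (Op ` {ts. set ts \<subseteq> ?S \<and> length ts = p})"
    proof (cases t)
      case (Op ts)
      have "op_count u < n" if "u \<in> set ts" for u
        using t Op member_le_sum_list[of "op_count u" "map op_count ts"] that by fastforce
      then show ?thesis using t Op by auto
    qed simp
  qed
  then show ?case
    using finite_lists_length_eq[OF Suc.IH, of p] by (meson finite.insertI finite_imageI finite_subset)
qed

section \<open>Substitution of bracketings for numbered leaves\<close>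

lemma number_vars_list_append:
  "number_vars_list k (ts @ us) =
     number_vars_list k ts @ number_vars_list (k + sum_list (map var_count ts)) us"
  by (induction ts arbitrary: k) (simp_all add: add.assoc)

lemma length_number_vars_list [simp]: "length (number_vars_list k ts) = length ts"
  by (induction ts arbitrary: k) simp_all

text \<open>Simultaneous substitution is evaluation in the term algebra, whose operation is
  \<open>Op\<close>: the leaf numbered \<open>j\<close>, counting from \<open>k\<close>, is replaced
  by \<open>r j\<close>.\<close>

abbreviation leaf_subst :: "(nat \<Rightarrow> 'w trm) \<Rightarrow> nat \<Rightarrow> 'v trm \<Rightarrow> 'w trm" where
  "leaf_subst r k t \<equiv> eval_trm Op r (number_vars k t)"

abbreviation leaf_subst_list :: "(nat \<Rightarrow> 'w trm) \<Rightarrow> nat \<Rightarrow> 'v trm list \<Rightarrow> 'w trm list" where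
  "leaf_subst_list r k ts \<equiv> map (eval_trm Op r) (number_vars_list k ts)"

lemma sum_shift_split:
  fixes g :: "nat \<Rightarrow> nat"
  shows "sum g {k..<k + (a + b)} = sum g {k..<k + a} + sum g {k + a..<k + a + b}"
  by (metis add.assoc le_add1 sum.atLeastLessThan_concat)

lemma var_count_leaf_subst:
  fixes t :: "'v trm" and ts :: "'v trm list"
  shows "var_count (leaf_subst r k t) = (\<Sum>j = k..<k + var_count t. var_count (r j))"
    and "sum_list (map var_count (leaf_subst_list r k ts)) =
           (\<Sum>j = k..<k + sum_list (map var_count ts). var_count (r j))"
  by (induction k t and k ts rule: number_vars_number_vars_list.induct)
     (simp_all add: sum_shift_split del: sum.op_ivl_Suc)

lemma op_count_leaf_subst:
  fixes t :: "'v trm" and ts :: "'v trm list"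
  shows "op_count (leaf_subst r k t) = op_count t + (\<Sum>j = k..<k + var_count t. op_count (r j))"
    and "sum_list (map op_count (leaf_subst_list r k ts)) =
           sum_list (map op_count ts) + (\<Sum>j = k..<k + sum_list (map var_count ts). op_count (r j))"
  by (induction k t and k ts rule: number_vars_number_vars_list.induct)
     (simp_all add: sum_shift_split del: sum.op_ivl_Suc)

lemma leaf_subst_in_bracketings:
  assumes "\<And>j. r j \<in> bracketings p"
  shows "t \<in> bracketings p \<Longrightarrow> leaf_subst r k t \<in> bracketings p"
    and "set ts \<subseteq> bracketings p \<Longrightarrow> set (leaf_subst_list r k ts) \<subseteq> bracketings p"
  using assms
  by (induction k t and k ts rule: number_vars_number_vars_list.induct) simp_all

lemma leaf_subst_id:
  fixes t :: "unit trm" and ts :: "unit trm list"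
  shows "(\<And>j. k \<le> j \<Longrightarrow> j < k + var_count t \<Longrightarrow> r j = X) \<Longrightarrow> leaf_subst r k t = t"
    and "(\<And>j. k \<le> j \<Longrightarrow> j < k + sum_list (map var_count ts) \<Longrightarrow> r j = X) \<Longrightarrow> leaf_subst_list r k ts = ts"
  by (induction k t and k ts rule: number_vars_number_vars_list.induct) simp_all

text \<open>Allows an identity numbered from 1 to be applied to a subterm whose leaves are numbered
  from a later position.\<close>

lemma eval_number_vars_shift:
  fixes t :: "'v trm" and ts :: "'v trm list"
  shows "eval_trm f h (number_vars (k + d) t) = eval_trm f (\<lambda>v. h (v + d)) (number_vars k t)"
    and "map (eval_trm f h) (number_vars_list (k + d) ts) =
           map (eval_trm f (\<lambda>v. h (v + d))) (number_vars_list k ts)"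
  by (induction k t and k ts rule: number_vars_number_vars_list.induct)
     (simp_all add: add.commute add.left_commute)

lemma eval_in_carrier:
  assumes "p_groupoid p A f" "\<And>v. h v \<in> A"
  shows "t \<in> bracketings p \<Longrightarrow> eval_trm f h (number_vars k t) \<in> A"
    and "set ts \<subseteq> bracketings p \<Longrightarrow> set (map (eval_trm f h) (number_vars_list k ts)) \<subseteq> A"
  using assms
  by (induction k t and k ts rule: number_vars_number_vars_list.induct)
     (simp_all add: p_groupoid_def)

text \<open>
  \<open>off j\<close> is the position of the first leaf of the bracketing substituted for leaf \<open>j\<close>.
\<close>

lemma eval_number_vars_leaf_subst:
  fixes t :: "'v trm" and ts :: "'v trm list" and r :: "nat \<Rightarrow> 'w trm"
  assumes "\<And>j. j \<ge> k \<Longrightarrow> off (Suc j) = off j + var_count (r j)"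
  shows "eval_trm f h (number_vars (off k) (leaf_subst r k t)) =
           eval_trm f (\<lambda>j. eval_trm f h (number_vars (off j) (r j))) (number_vars k t)"
    and "map (eval_trm f h) (number_vars_list (off k) (leaf_subst_list r k ts)) =
           map (eval_trm f (\<lambda>j. eval_trm f h (number_vars (off j) (r j)))) (number_vars_list k ts)"
  using assms
proof (induction k t and k ts rule: number_vars_number_vars_list.induct)
  case (4 k t ts)
  \<comment> \<open>Telescoping: the leaves coming from the remaining arguments start at
    \<open>off (k + var_count t)\<close>.\<close>
  have "off k + (\<Sum>j = k..<k + m. var_count (r j)) = off (k + m)" for m
    by (induction m) (simp_all add: "4.prems")
  with 4 show ?case
    by (simp add: var_count_leaf_subst)
qed simp_all

section \<open>The fine spectrum as a congruence closed under leaf substitution\<close>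

lemma fine_spectrum_iff:
  "(s, t) \<in> fine_spectrum p A f \<longleftrightarrow>
     s \<in> bracketings p \<and> t \<in> bracketings p \<and> op_count s = op_count t \<and>
     (\<forall>h. (\<forall>v. h v \<in> A) \<longrightarrow>
        eval_trm f h (number_vars 1 s) = eval_trm f h (number_vars 1 t))"
  by (auto simp: fine_spectrum_def Lambda_def satisfies_identity_def epsilon1_def)

lemma fine_spectrum_refl: "t \<in> bracketings p \<Longrightarrow> (t, t) \<in> fine_spectrum p A f"
  by (simp add: fine_spectrum_iff)

lemma fine_spectrum_sym: "(s, t) \<in> fine_spectrum p A f \<Longrightarrow> (t, s) \<in> fine_spectrum p A f"
  by (simp add: fine_spectrum_iff)

lemma fine_spectrum_trans [trans]:
  "(s, t) \<in> fine_spectrum p A f \<Longrightarrow> (t, u) \<in> fine_spectrum p A f \<Longrightarrow> (s, u) \<in> fine_spectrum p A f"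
  by (simp add: fine_spectrum_iff)

lemma fine_spectrum_eval:
  assumes "(s, t) \<in> fine_spectrum p A f" "k \<ge> 1" "\<And>v. h v \<in> A"
  shows "eval_trm f h (number_vars k s) = eval_trm f h (number_vars k t)"
proof -
  have "eval_trm f h (number_vars k u) = eval_trm f (\<lambda>v. h (v + (k - 1))) (number_vars 1 u)"
    for u :: "unit trm"
    using eval_number_vars_shift(1)[of f h 1 "k - 1" u] assms(2) by simp
  with assms(1,3) show ?thesis
    by (simp add: fine_spectrum_iff)
qed

text \<open>Related arguments have the same number of leaves, so corresponding arguments on both
  sides are numbered from the same position and can be compared one by one.\<close>

lemma fine_spectrum_Op:
  assumes "p \<ge> 1" "list_all2 (\<lambda>s t. (s, t) \<in> fine_spectrum p A f) ss ts" "length ss = p"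
  shows "(Op ss, Op ts) \<in> fine_spectrum p A f"
proof -
  have "sum_list (map op_count ss) = sum_list (map op_count ts) \<and>
      set ss \<subseteq> bracketings p \<and> set ts \<subseteq> bracketings p"
    using assms(2) by induction (simp_all add: fine_spectrum_iff)
  moreover have "map (eval_trm f h) (number_vars_list k ss) =
      map (eval_trm f h) (number_vars_list k ts)" if "\<And>v. h v \<in> A" "k \<ge> 1" for h k
    using assms(2) \<open>k \<ge> 1\<close>
  proof (induction arbitrary: k)
    case (Cons s ss t ts)
    have "var_count s = var_count t"
      using Cons.hyps(1) \<open>p \<ge> 1\<close> by (auto simp: fine_spectrum_iff var_count_bracketing)
    with Cons fine_spectrum_eval[OF Cons.hyps(1), of k h] that show ?case
      by simp
  qed simp
  ultimately show ?thesis
    using assms(3) list_all2_lengthD[OF assms(2)] by (auto simp: fine_spectrum_iff)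
qed

text \<open>Evaluating the substituted terms amounts to evaluating \<open>s\<close> and
  \<open>t\<close> at the values of the \<open>r j\<close>. These values are the same for both,
  since \<open>off j\<close> depends only on \<open>r\<close>.\<close>

lemma fine_spectrum_leaf_subst:
  assumes "p_groupoid p A f" "p \<ge> 1" "(s, t) \<in> fine_spectrum p A f" "\<And>j. r j \<in> bracketings p"
  shows "(leaf_subst r 1 s, leaf_subst r 1 t) \<in> fine_spectrum p A f"
proof -
  have st: "s \<in> bracketings p" "t \<in> bracketings p" "op_count s = op_count t"
    using assms(3) by (simp_all add: fine_spectrum_iff)
  then have "var_count s = var_count t"
    using \<open>p \<ge> 1\<close> by (simp add: var_count_bracketing)
  moreover have "eval_trm f h (number_vars 1 (leaf_subst r 1 s)) =
      eval_trm f h (number_vars 1 (leaf_subst r 1 t))" if h: "\<And>v. h v \<in> A" for h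
  proof -
    define off where "off j = 1 + (\<Sum>l = 1..<j. var_count (r l))" for j :: nat
    have off: "off (Suc j) = off j + var_count (r j)" if "j \<ge> 1" for j
      using that by (simp add: off_def)
    have "off 1 = 1" by (simp add: off_def)
    then have "eval_trm f h (number_vars 1 (leaf_subst r 1 u)) =
        eval_trm f (\<lambda>j. eval_trm f h (number_vars (off j) (r j))) (number_vars 1 u)" for u :: "unit trm"
      using eval_number_vars_leaf_subst(1)[of 1 off r f h u] off by simp
    moreover have "eval_trm f h (number_vars (off j) (r j)) \<in> A" for j
      using eval_in_carrier(1)[OF assms(1) h assms(4)] .
    ultimately show ?thesis
      using fine_spectrum_eval[OF assms(3), of 1] by simp
  qed
  ultimately show ?thesis
    using st assms(4) by (simp add: fine_spectrum_iff leaf_subst_in_bracketings op_count_leaf_subst)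
qed

section \<open>Expanding a leaf to a single operation node\<close>

abbreviation expand_leaf :: "nat \<Rightarrow> nat \<Rightarrow> nat \<Rightarrow> unit trm \<Rightarrow> unit trm" where
  "expand_leaf p i \<equiv> leaf_subst ((\<lambda>_. X)(i := Op (replicate p X)))"

abbreviation expand_leaf_list :: "nat \<Rightarrow> nat \<Rightarrow> nat \<Rightarrow> unit trm list \<Rightarrow> unit trm list" where
  "expand_leaf_list p i \<equiv> leaf_subst_list ((\<lambda>_. X)(i := Op (replicate p X)))"

lemma expand_leaf_list_outside:
  "i < k \<or> k + sum_list (map var_count ts) \<le> i \<Longrightarrow> expand_leaf_list p i k ts = ts"
  by (rule leaf_subst_id(2)) auto

lemma sum_list_replicate_nat [simp]: "sum_list (replicate m c) = m * (c::nat)"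
  by (simp add: sum_list_replicate)

lemma expand_leaf_in_bracketings:
  "t \<in> bracketings p \<Longrightarrow> expand_leaf p i k t \<in> bracketings p"
  by (rule leaf_subst_in_bracketings(1)) auto

lemma op_count_expand_leaf:
  assumes "k \<le> i" "i < k + var_count t"
  shows "op_count (expand_leaf p i k t) = Suc (op_count t)"
proof -
  have "(\<Sum>j = k..<k + var_count t. op_count (((\<lambda>_. X)(i := Op (replicate p X))) j)) =
      (\<Sum>j = k..<k + var_count t. if j = i then 1 else 0)"
    by (rule sum.cong) auto
  with assms show ?thesis
    by (simp add: op_count_leaf_subst del: fun_upd_apply)
qed

text \<open>An innermost operation node has only leaves as arguments; contracting it to a leaf gives
  \<open>u\<close>, and \<open>i\<close> is the number of that leaf.\<close>

lemma expand_leaf_surj: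
  assumes "t \<in> bracketings p" "op_count t > 0"
  obtains u i where "u \<in> bracketings p" "k \<le> i" "i < k + var_count u"
    "op_count t = Suc (op_count u)" "expand_leaf p i k u = t"
proof -
  have "\<exists>u i. u \<in> bracketings p \<and> k \<le> i \<and> i < k + var_count u \<and> expand_leaf p i k u = t"
    using assms
  proof (induction t arbitrary: k rule: trm.induct)
    case (Var u)
    then show ?case by simp
  next
    case (Op ts)
    show ?case
    proof (cases "\<exists>t \<in> set ts. op_count t > 0")
      case False
      have "t = X" if "t \<in> set ts" for t
        using False that by (cases t) auto
      then have "ts = replicate p X"
        using Op.prems by (auto intro: replicate_eqI)
      then have "expand_leaf p k k X = Op ts" by simp
      then show ?thesis by (intro exI[of _ X] exI[of _ k]) simp
    next
      case True
      then obtain as t bs where ts: "ts = as @ t # bs" and t: "op_count t > 0"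
        by (metis split_list)
      define l where "l = k + sum_list (map var_count as)"
      have "t \<in> set ts" "t \<in> bracketings p"
        using Op.prems ts by simp_all
      then obtain u i where
        u: "u \<in> bracketings p" "l \<le> i" "i < l + var_count u" "expand_leaf p i l u = t"
        using Op.IH[OF _ _ t, of l] by blast
      have "expand_leaf_list p i k as = as" "expand_leaf_list p i (l + var_count u) bs = bs"
        using u(2,3) by (intro expand_leaf_list_outside; simp add: l_def)+
      then have "expand_leaf p i k (Op (as @ u # bs)) = Op ts"
        using u(4) by (simp add: ts number_vars_list_append l_def del: fun_upd_apply)
      moreover have "Op (as @ u # bs) \<in> bracketings p"
        using Op.prems u(1) ts by simp
      ultimately show ?thesis
        using u(2,3) by (intro exI[of _ "Op (as @ u # bs)"] exI[of _ i])
          (simp add: l_def del: fun_upd_apply)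
    qed
  qed
  then show ?thesis
    using that op_count_expand_leaf by metis
qed

abbreviation left_node :: "nat \<Rightarrow> unit trm \<Rightarrow> unit trm" where
  "left_node p t \<equiv> Op (t # replicate (p - 1) X)"

abbreviation right_node :: "nat \<Rightarrow> unit trm \<Rightarrow> unit trm" where
  "right_node p t \<equiv> Op (replicate (p - 1) X @ [t])"

lemma left_node_in_bracketings: "p \<ge> 1 \<Longrightarrow> t \<in> bracketings p \<Longrightarrow> left_node p t \<in> bracketings p"
  by auto

lemma right_node_in_bracketings: "p \<ge> 1 \<Longrightarrow> t \<in> bracketings p \<Longrightarrow> right_node p t \<in> bracketings p"
  by auto

lemma expand_left_node:
  "i < k + var_count t \<Longrightarrow> expand_leaf p i k (left_node p t) = left_node p (expand_leaf p i k t)"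
  by (simp add: expand_leaf_list_outside del: fun_upd_apply)

text \<open>The numbering of \<open>t\<close> starts at \<open>k + (p - 1)\<close>, after the
  \<open>p - 1\<close> single leaves, which the expansion of a later leaf does not touch.\<close>

lemma expand_right_node:
  assumes "k + (p - 1) \<le> i"
  shows "expand_leaf p i k (right_node p t) = right_node p (expand_leaf p i (k + (p - 1)) t)"
  using assms by (simp add: number_vars_list_append expand_leaf_list_outside del: fun_upd_apply)

lemma bracketing_of_size_exists:
  assumes "p \<ge> 1"
  obtains t where "t \<in> bracketings p" "op_count t = m"
proof -
  have "\<exists>t \<in> bracketings p. op_count t = m"
  proof (induction m)
    case 0
    show ?case by (rule bexI[of _ X]) simp_all
  next
    case (Suc m)
    then obtain t where "t \<in> bracketings p" "op_count t = m" by blast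
    then show ?case
      using left_node_in_bracketings[OF assms] by (intro bexI[of _ "left_node p t"]) simp_all
  qed
  then show ?thesis using that by blast
qed

section \<open>Collapse at one size passes to all larger sizes\<close>

definition all_equivalent :: "nat \<Rightarrow> 'a set \<Rightarrow> ('a list \<Rightarrow> 'a) \<Rightarrow> nat \<Rightarrow> bool" where
  "all_equivalent p A f m \<longleftrightarrow>
     bracketings_of_size p m \<times> bracketings_of_size p m \<subseteq> fine_spectrum p A f"

lemma all_equivalentD:
  assumes "all_equivalent p A f m" "s \<in> bracketings p" "op_count s = m"
    "t \<in> bracketings p" "op_count t = m"
  shows "(s, t) \<in> fine_spectrum p A f"
  using assms by (auto simp: all_equivalent_def bracketings_of_size_def)

lemma all_equivalent_Suc:
  assumes A: "p_groupoid p A f" and p: "p \<ge> 2" and m: "m \<ge> 2" and eq: "all_equivalent p A f m"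
  shows "all_equivalent p A f (Suc m)"
proof -
  have p1: "p \<ge> 1" using p by simp
  obtain s0 where s0: "s0 \<in> bracketings p" "op_count s0 = m - 1"
    using bracketing_of_size_exists[OF p1] .
  have vc: "var_count s0 = (p - 1) * (m - 1) + 1"
    using s0 p by (simp add: var_count_bracketing)
  have "(p - 1) * 1 \<le> (p - 1) * (m - 1)"
    using m by (intro mult_le_mono) simp_all
  \<comment> \<open>Since \<open>m \<ge> 2\<close>, \<open>s0\<close> contains an operation node and
    so at least \<open>p\<close> leaves. Thus leaf \<open>p\<close> belongs to \<open>s0\<close> in
    \<open>left_node p s0\<close>, and it is the first leaf of \<open>s0\<close> in
    \<open>right_node p s0\<close>.\<close>
  then have ps0: "p \<le> var_count s0" unfolding vc using p by linarith
  have nodes: "left_node p s0 \<in> bracketings p" "right_node p s0 \<in> bracketings p"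
    "op_count (left_node p s0) = m" "op_count (right_node p s0) = m"
    using s0 m p1 left_node_in_bracketings right_node_in_bracketings by simp_all
  have expand: "(expand_leaf p i 1 s, expand_leaf p i 1 t) \<in> fine_spectrum p A f"
    if "s \<in> bracketings p" "op_count s = m" "t \<in> bracketings p" "op_count t = m" for s t i
    by (rule fine_spectrum_leaf_subst[OF A p1 all_equivalentD[OF eq that]]) auto
  have left_right: "(left_node p s, right_node p t) \<in> fine_spectrum p A f"
    if s: "s \<in> bracketings p" "op_count s = m" and t: "t \<in> bracketings p" "op_count t = m" for s t
  proof -
    \<comment> \<open>Both terms have size \<open>m\<close>, so \<open>s\<close> may be exchanged
      for an expansion of \<open>s0\<close>; the expansion can then be moved outside the
      node.\<close>
    have "(s, expand_leaf p p 1 s0) \<in> fine_spectrum p A f"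
      using p ps0 s0 s m
      by (intro all_equivalentD[OF eq] expand_leaf_in_bracketings)
         (simp_all add: op_count_expand_leaf del: fun_upd_apply)
    then have "(left_node p s, left_node p (expand_leaf p p 1 s0)) \<in> fine_spectrum p A f"
      using p by (intro fine_spectrum_Op)
        (auto simp: list_all2_same fine_spectrum_refl simp del: fun_upd_apply)
    also have "left_node p (expand_leaf p p 1 s0) = expand_leaf p p 1 (left_node p s0)"
      using ps0 by (intro expand_left_node[symmetric]) simp
    also have "(\<dots>, expand_leaf p p 1 (right_node p s0)) \<in> fine_spectrum p A f"
      by (intro expand nodes)
    also have "expand_leaf p p 1 (right_node p s0) = right_node p (expand_leaf p p p s0)"
      using expand_right_node[of 1 p p s0] p by simp
    also have "(\<dots>, right_node p t) \<in> fine_spectrum p A f"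
    proof -
      have "(expand_leaf p p p s0, t) \<in> fine_spectrum p A f"
        using p ps0 s0 t m
        by (intro all_equivalentD[OF eq] expand_leaf_in_bracketings)
           (simp_all add: op_count_expand_leaf del: fun_upd_apply)
      then show ?thesis
        using p by (intro fine_spectrum_Op)
          (auto simp: list_all2_same fine_spectrum_refl list_all2_append simp del: fun_upd_apply)
    qed
    finally show ?thesis .
  qed
  obtain s1 where s1: "s1 \<in> bracketings p" "op_count s1 = m"
    using bracketing_of_size_exists[OF p1] .
  have normal: "(t, right_node p s1) \<in> fine_spectrum p A f"
    if t: "t \<in> bracketings p" "op_count t = Suc m" for t
  proof -
    obtain u i where u: "u \<in> bracketings p" "1 \<le> i" "i < 1 + var_count u"
      "op_count t = Suc (op_count u)" "expand_leaf p i 1 u = t"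
      using expand_leaf_surj[OF t(1), of 1] t(2) by auto
    have um: "op_count u = m" using u t by simp
    show ?thesis
    proof (cases "i \<le> p")
      \<comment> \<open>Leaf \<open>i\<close> lies in the first argument of
        \<open>left_node p s0\<close>, so that form can replace \<open>u\<close> before
        expanding.\<close>
      case True
      then have i: "i < 1 + var_count s0" using ps0 by simp
      have "(t, expand_leaf p i 1 (left_node p s0)) \<in> fine_spectrum p A f"
        unfolding u(5)[symmetric] by (intro expand u um nodes)
      also have "expand_leaf p i 1 (left_node p s0) = left_node p (expand_leaf p i 1 s0)"
        using i by (rule expand_left_node)
      also have "(\<dots>, right_node p s1) \<in> fine_spectrum p A f"
        using u(2) i s0 s1 m
        by (intro left_right expand_leaf_in_bracketings)
           (simp_all add: op_count_expand_leaf del: fun_upd_apply)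
      finally show ?thesis .
    next
      case False
      have "var_count u = (p - 1) * m + 1"
        using u(1) um p by (simp add: var_count_bracketing)
      \<comment> \<open>As \<open>u\<close> and \<open>right_node p s0\<close> have equally many
        leaves, every leaf numbered above \<open>p\<close> lies in the last argument of the
        latter.\<close>
      also have "\<dots> = var_count s0 + (p - 1)"
        using vc m by (cases m) simp_all
      finally have i: "p \<le> i" "i < p + var_count s0" using False u(3) p by simp_all
      have "(t, expand_leaf p i 1 (right_node p s0)) \<in> fine_spectrum p A f"
        unfolding u(5)[symmetric] by (intro expand u um nodes)
      also have "expand_leaf p i 1 (right_node p s0) = right_node p (expand_leaf p i p s0)"
        using expand_right_node[of 1 p i s0] i p by simp
      \<comment> \<open>\<open>left_right\<close> links only opposite forms, so two right forms are
        linked through a left one.\<close>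
      also have "(\<dots>, left_node p s1) \<in> fine_spectrum p A f"
        using i s0 s1 m
        by (intro fine_spectrum_sym[OF left_right] expand_leaf_in_bracketings)
           (simp_all add: op_count_expand_leaf del: fun_upd_apply)
      also have "(left_node p s1, right_node p s1) \<in> fine_spectrum p A f"
        by (intro left_right s1)
      finally show ?thesis .
    qed
  qed
  show ?thesis
    unfolding all_equivalent_def bracketings_of_size_def
    using fine_spectrum_trans[OF normal fine_spectrum_sym[OF normal]] by auto
qed

lemma all_equivalent_ge:
  assumes "p_groupoid p A f" "p \<ge> 2" "n \<ge> 2" "all_equivalent p A f n" "m \<ge> n"
  shows "all_equivalent p A f m"
  using assms(5)
proof (induction m rule: dec_induct)
  case (step m)
  then show ?case using assms all_equivalent_Suc by (metis order_trans)
qed (rule assms)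

text \<open>The image of each term of size \<open>n\<close> is the unique class, and by reflexivity
  each term lies in its own image.\<close>

lemma assoc_spectrum_eq_1_imp_all_equivalent:
  assumes "assoc_spectrum p A f n = 1"
  shows "all_equivalent p A f n"
proof -
  let ?R = "fine_spectrum_at p A f n" and ?S = "bracketings_of_size p n"
  obtain C where C: "?S // ?R = {C}"
    using assms by (auto simp: assoc_spectrum_def card_1_singleton_iff)
  have "(s, t) \<in> fine_spectrum p A f" if "s \<in> ?S" "t \<in> ?S" for s t
  proof -
    have "?R `` {s} = C" "?R `` {t} = C"
      using C that by (auto simp: quotient_def)
    moreover have "t \<in> ?R `` {t}"
      using that by (auto simp: fine_spectrum_at_def bracketings_of_size_def fine_spectrum_refl)
    ultimately show ?thesis by (auto simp: fine_spectrum_at_def)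
  qed
  then show ?thesis by (auto simp: all_equivalent_def)
qed

section \<open>The finite quotient of the bracketings\<close>

theorem proposition7p3:
  fixes p n :: nat and A :: "'a set" and f :: "'a list \<Rightarrow> 'a"
  assumes "p \<ge> 2"
    and "p_groupoid p A f"
    and "n \<ge> 2"
    and "assoc_spectrum p A f n = 1"
  shows "\<exists>(B :: nat set) (g :: nat list \<Rightarrow> nat).
           p_groupoid p B g \<and> finite B \<and> fine_spectrum p B g = fine_spectrum p A f"
proof -
  let ?T = "bracketings p" and ?\<sigma> = "fine_spectrum p A f"
  have p1: "p \<ge> 1" using assms(1) by simp
  have large: "(s, t) \<in> ?\<sigma>" if "s \<in> ?T" "t \<in> ?T" "op_count s = op_count t" "n \<le> op_count t" for s t
    using all_equivalent_ge[OF assms(2,1,3) assoc_spectrum_eq_1_imp_all_equivalent[OF assms(4)] that(4)]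
      all_equivalentD that by metis
  \<comment> \<open>The empty set serves as the absorbing element, since \<open>\<sigma>\<close>-classes are nonempty.\<close>
  define C where "C t = (if op_count t < n then ?\<sigma> `` {t} else {})" for t
  have "C ` ?T \<subseteq> insert {} (C ` {t \<in> ?T. op_count t < n})"
    by (auto simp: C_def)
  then have fin: "finite (C ` ?T)"
    using finite_bracketings_less by (meson finite.insertI finite_imageI finite_subset)
  \<comment> \<open>Codes the finitely many collapsed classes as natural numbers, so that the
    carrier is a \<open>nat set\<close>.\<close>
  then obtain e :: "unit trm set \<Rightarrow> nat" where e: "inj_on e (C ` ?T)"
    using finite_imp_inj_to_nat_seg by blast
  define c where "c t = e (C t)" for t
  \<comment> \<open>The kernel of \<open>c\<close> is \<open>\<sigma>\<close> enlarged by all pairs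
    of terms of size at least \<open>n\<close>, even of different sizes.\<close>
  have c_eq_iff: "c s = c t \<longleftrightarrow> (s, t) \<in> ?\<sigma> \<or> n \<le> op_count s \<and> n \<le> op_count t"
    if "s \<in> ?T" "t \<in> ?T" for s t
  proof -
    have "c s = c t \<longleftrightarrow> C s = C t"
      using e that by (auto simp: c_def inj_on_def)
    also have "\<dots> \<longleftrightarrow> (s, t) \<in> ?\<sigma> \<or> n \<le> op_count s \<and> n \<le> op_count t"
    proof -
      have "?\<sigma> `` {s} = ?\<sigma> `` {t} \<longleftrightarrow> (s, t) \<in> ?\<sigma>"
        using that fine_spectrum_refl fine_spectrum_sym fine_spectrum_trans by fast
      moreover have "?\<sigma> `` {s} \<noteq> {}" "?\<sigma> `` {t} \<noteq> {}"
        using that fine_spectrum_refl by fast+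
      moreover have "op_count s = op_count t" if "(s, t) \<in> ?\<sigma>"
        using that by (simp add: fine_spectrum_iff)
      ultimately show ?thesis
        by (auto simp: C_def)
    qed
    finally show ?thesis .
  qed
  \<comment> \<open>\<open>d\<close> selects a representative of each class; \<open>g\<close>
    applies \<open>Op\<close> to representatives.\<close>
  define d where "d = inv_into ?T c"
  have d: "d (c t) \<in> ?T" "c (d (c t)) = c t" if "t \<in> ?T" for t
    using that by (auto simp: d_def inv_into_into f_inv_into_f)
  define g where "g ns = c (Op (map d ns))" for ns
  \<comment> \<open>\<open>c\<close> is a homomorphism: either all representatives are
    \<open>\<sigma>\<close>-related to the original arguments and congruence applies, or some
    argument and its representative both have size at least \<open>n\<close>, and then both compound
    terms are collapsed.\<close>
  have c_Op: "g (map c ts) = c (Op ts)" if ts: "Op ts \<in> ?T" for ts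
  proof -
    let ?us = "map (d \<circ> c) ts"
    have us: "Op ?us \<in> ?T" using ts d(1) by auto
    have cong: "(d (c t), t) \<in> ?\<sigma> \<or> n \<le> op_count (d (c t)) \<and> n \<le> op_count t" if "t \<in> set ts" for t
      using that ts d[of t] c_eq_iff[of "d (c t)" t] by auto
    show ?thesis
    proof (cases "\<forall>t \<in> set ts. (d (c t), t) \<in> ?\<sigma>")
      case True
      then have "(Op ?us, Op ts) \<in> ?\<sigma>"
        using ts p1 by (intro fine_spectrum_Op) (auto simp: list_all2_map1 list_all2_same)
      then show ?thesis using c_eq_iff us ts by (auto simp: g_def)
    next
      case False
      then obtain t where t: "t \<in> set ts" "n \<le> op_count (d (c t))" "n \<le> op_count t"
        using cong by blast
      have "n \<le> op_count (Op ?us)" "n \<le> op_count (Op ts)"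
        using t member_le_sum_list[of "op_count t" "map op_count ts"]
          member_le_sum_list[of "op_count (d (c t))" "map op_count ?us"] by fastforce+
      then show ?thesis using c_eq_iff us ts by (auto simp: g_def)
    qed
  qed
  have eval: "eval_trm g (\<lambda>v. c (r v)) (number_vars k t) = c (leaf_subst r k t)"
    if "t \<in> ?T" and r: "\<And>v. r v \<in> ?T" for r k and t :: "unit trm"
  proof -
    have "t \<in> ?T \<Longrightarrow> eval_trm g (\<lambda>v. c (r v)) (number_vars k t) = c (leaf_subst r k t)"
      and "set ts \<subseteq> ?T \<Longrightarrow> map (eval_trm g (\<lambda>v. c (r v))) (number_vars_list k ts) =
        map c (leaf_subst_list r k ts)" for ts :: "unit trm list"
    proof (induction k t and k ts rule: number_vars_number_vars_list.induct)
      case (2 k ts)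
      then have "Op (leaf_subst_list r k ts) \<in> ?T"
        using leaf_subst_in_bracketings(2)[of r p ts k] r by simp
      from c_Op[OF this] 2 show ?case
        by (simp del: map_map map_eq_conv)
    qed simp_all
    then show ?thesis using that by blast
  qed
  have "g ns \<in> c ` ?T" if "length ns = p" "set ns \<subseteq> c ` ?T" for ns
    using that d(1) unfolding g_def by (intro imageI) auto
  then have "p_groupoid p (c ` ?T) g"
    using Var_in_bracketings[of "()" p] unfolding p_groupoid_def by blast
  moreover have "finite (c ` ?T)"
    using finite_imageI[OF fin, of e] by (simp add: image_image c_def)
  moreover have "fine_spectrum p (c ` ?T) g = ?\<sigma>"
  proof (intro equalityI subrelI)
    fix s t assume st: "(s, t) \<in> fine_spectrum p (c ` ?T) g"
    then have T: "s \<in> ?T" "t \<in> ?T" "op_count s = op_count t"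
      by (simp_all add: fine_spectrum_iff)
    \<comment> \<open>Assigning the class of \<open>X\<close> to every variable evaluates a
      bracketing to its own class.\<close>
    have "leaf_subst (\<lambda>_. X) 1 u = u" for u
      by (rule leaf_subst_id(1)) simp
    then have "c s = c t"
      using fine_spectrum_eval[OF st, of 1 "\<lambda>_. c X"] eval[of _ "\<lambda>_. X" 1] T by simp
    \<comment> \<open>If \<open>c\<close> merges the terms because both have size at least
      \<open>n\<close>, their equal sizes still put them in \<open>\<sigma>\<close> by
      \<open>large\<close>.\<close>
    then show "(s, t) \<in> ?\<sigma>"
      using c_eq_iff[OF T(1,2)] large[OF T] by blast
  next
    fix s t assume st: "(s, t) \<in> ?\<sigma>"
    then have T: "s \<in> ?T" "t \<in> ?T" "op_count s = op_count t"
      by (simp_all add: fine_spectrum_iff)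
    have "eval_trm g h (number_vars 1 s) = eval_trm g h (number_vars 1 t)"
      if "\<And>v. h v \<in> c ` ?T" for h
    proof -
      \<comment> \<open>Lifting the assignment to representatives turns evaluation under
        \<open>g\<close> into leaf substitution, under which \<open>\<sigma>\<close> is
        closed.\<close>
      define r where "r v = d (h v)" for v
      have r: "r v \<in> ?T" "h v = c (r v)" for v
        using that[of v] d by (auto simp: r_def)
      then have "h = (\<lambda>v. c (r v))" by blast
      moreover have "c (leaf_subst r 1 s) = c (leaf_subst r 1 t)"
        using fine_spectrum_leaf_subst[OF assms(2) p1 st, of r] c_eq_iff r(1) T
        by (simp add: leaf_subst_in_bracketings)
      ultimately show ?thesis using eval r(1) T by simp
    qed
    then show "(s, t) \<in> fine_spectrum p (c ` ?T) g"
      using T by (simp add: fine_spectrum_iff)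
  qed
  ultimately show ?thesis by blast
qed

end
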